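(* Let $a>1$ be an integer. If $n$ is an overpseudoprime to base $a$ and $n$ is not divisible by $p^2$ for any Wieferich prime $p$ in base $a$, then $n$ is squarefree.
   Context: A prime $p$ is a Wieferich prime in base $a$ if $a^{p-1}\equiv1\pmod{p^2}$. For an integer $m>1$ with $\gcd(m,a)=1$, $h_a(m)$ denotes the multiplicative order of $a$ modulo $m$. The cyclotomic cosets of $a$ modulo $m$ are the orbits of $\{1,2,\ldots,m-1\}$ under $x\mapsto ax\bmod m$; $r_a(m)$ denotes their number. An odd composite number $n$ with $\gcd(n,a)=1$ is called an overpseudoprime to base $a$ if $n=r_a(n)h_a(n)+1$. *)

theory Defs
  imports "HOL-Number_Theory.Number_Theory" "HOL-Computational_Algebra.Squarefree" "HOL-Combinatorics.Orbits"
begin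

definition wieferich_prime :: "nat \<Rightarrow> nat \<Rightarrow> bool" where
  "wieferich_prime a p \<longleftrightarrow> prime p \<and> [a ^ (p - 1) = 1] (mod p ^ 2)"

text \<open>
  The library's \<open>orbit f x\<close> consists of the iterates \<open>(f ^^ k) x\<close> with \<open>k > 0\<close>. For
  \<open>coprime m a\<close>, multiplication by \<open>a\<close> permutes \<open>{1..m - 1}\<close>, so \<open>x\<close> itself lies in
  its orbit and the orbits partition \<open>{1..m - 1}\<close>.
\<close>

definition cyclotomic_cosets :: "nat \<Rightarrow> nat \<Rightarrow> nat set set" where
  "cyclotomic_cosets a m = orbit (\<lambda>x. a * x mod m) ` {1..m - 1}"

definition num_cyclotomic_cosets :: "nat \<Rightarrow> nat \<Rightarrow> nat" where
  "num_cyclotomic_cosets a m = card (cyclotomic_cosets a m)"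

text \<open>\<open>ord n a\<close> takes the modulus first: it is the multiplicative order of \<open>a\<close> modulo \<open>n\<close>.\<close>

definition overpseudoprime :: "nat \<Rightarrow> nat \<Rightarrow> bool" where
  "overpseudoprime a n \<longleftrightarrow>
     odd n \<and> n > 1 \<and> \<not> prime n \<and> coprime n a \<and>
     n = num_cyclotomic_cosets a n * ord n a + 1"

end

theory Submission
  imports Defs
begin

text \<open>
  Multiplication by \<open>a\<close> has order \<open>h = ord n a\<close>, so every coset has at most \<open>h\<close> elements. The cosets
  cover the \<open>n - 1 = r h\<close> nonzero residues, hence each of them has exactly \<open>h\<close> elements. For a prime
  \<open>p\<close> dividing \<open>n\<close>, the coset of \<open>n / p\<close> has at most \<open>ord p a\<close> elements, so \<open>h = ord p a\<close> divides
  \<open>p - 1\<close> and \<open>n\<close> divides \<open>a\<^bsup>p - 1\<^esup> - 1\<close>. If \<open>p\<^sup>2\<close> divides \<open>n\<close>, then \<open>p\<close> is a Wieferich prime.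
\<close>

text \<open>The period \<open>k\<close> need not be minimal: reducing the exponent modulo
  \<open>k\<close> puts every iterate among the first \<open>k\<close>.\<close>

lemma card_orbit_le:
  fixes f :: "'a \<Rightarrow> 'a"
  assumes "k > 0" and "(f ^^ k) x = x"
  shows "card (orbit f x) \<le> k"
proof -
  have "(f ^^ m) x \<in> (\<lambda>i. (f ^^ i) x) ` {..<k}" for m
    using assms(1) by (intro image_eqI[of _ _ "m mod k"]) (simp_all add: funpow_mod_eq[OF assms(2)])
  then have sub: "orbit f x \<subseteq> (\<lambda>i. (f ^^ i) x) ` {..<k}"
    by (auto simp: orbit_altdef)
  show "card (orbit f x) \<le> k"
    using surj_card_le[OF _ sub] by simp
qed

lemma funpow_mult_mod:
  fixes a n x :: nat
  assumes "x < n"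
  shows "((\<lambda>x. a * x mod n) ^^ k) x = a ^ k * x mod n"
  using assms by (induction k) (simp_all add: mod_mult_right_eq mult.assoc)

text \<open>One member smaller than \<open>h\<close> would push the sum of the sizes, which bounds
  the size of the union, below \<open>card \<C> * h\<close>.\<close>

lemma card_eq_if_cover:
  assumes "finite \<C>" and "\<And>C. C \<in> \<C> \<Longrightarrow> card C \<le> h"
    and "card (\<Union>\<C>) = card \<C> * h" and "C \<in> \<C>"
  shows "card C = h"
proof (rule ccontr)
  assume "card C \<noteq> h"
  with assms(2,4) have "card C < h" by fastforce
  then have "(\<Sum>C\<in>\<C>. card C) < (\<Sum>C\<in>\<C>. h)"
    using assms by (intro sum_strict_mono_ex1) auto
  moreover have "card (\<Union>\<C>) \<le> (\<Sum>C\<in>\<C>. card C)"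
    by (rule card_Union_le_sum_card)
  ultimately show False
    using assms(3) by simp
qed

lemma overpseudoprime_card_orbit:
  assumes "overpseudoprime a n" and "x \<in> {1..n - 1}"
  shows "card (orbit (\<lambda>x. a * x mod n) x) = ord n a"
proof -
  let ?f = "\<lambda>x. a * x mod n"
  let ?h = "ord n a"
  have n: "n > 1" and cop: "coprime n a" and eq: "n - 1 = card (cyclotomic_cosets a n) * ?h"
    using assms(1) by (auto simp: overpseudoprime_def num_cyclotomic_cosets_def)
  \<comment> \<open>Coprimality excludes the default value 0 of \<open>ord\<close>.\<close>
  have h: "?h > 0"
    using cop by (simp add: coprime_commute)
  have period: "(?f ^^ ?h) y = y" if "y < n" for y
  proof -
    have "[a ^ ?h * y = 1 * y] (mod n)"
      by (intro cong_scalar_right ord)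
    then show ?thesis
      using that by (simp add: funpow_mult_mod cong_def)
  qed
  \<comment> \<open>\<open>orbit\<close> starts with the first iterate, so \<open>y\<close> enters
    only by returning after \<open>?h > 0\<close> steps.\<close>
  have self: "y \<in> orbit ?f y" if "y < n" for y
    using period[OF that] h unfolding orbit_altdef by (metis (mono_tags, lifting) mem_Collect_eq)
  have closed: "orbit ?f y \<subseteq> {1..n - 1}" if y: "y \<in> {1..n - 1}" for y
  proof
    fix z assume "z \<in> orbit ?f y"
    then obtain k where k: "z = (?f ^^ k) y"
      unfolding orbit_altdef by blast
    have "y < n"
      using y n by auto
    then have z: "z = a ^ k * y mod n"
      unfolding k by (rule funpow_mult_mod)
    \<comment> \<open>Powers of \<open>a\<close> are units modulo \<open>n\<close>, so no nonzero
      residue is sent to 0.\<close>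
    have "\<not> n dvd y"
      using y by (auto dest: dvd_imp_le)
    then have "\<not> n dvd a ^ k * y"
      using cop by (simp add: coprime_dvd_mult_right_iff)
    then have "z \<noteq> 0"
      by (simp add: z mod_eq_0_iff_dvd)
    moreover have "z < n"
      using z n by simp
    ultimately show "z \<in> {1..n - 1}"
      by simp
  qed
  have "\<Union>(cyclotomic_cosets a n) = {1..n - 1}"
    unfolding cyclotomic_cosets_def
  proof (intro equalityI UN_least closed subsetI)
    fix y assume y: "y \<in> {1..n - 1}"
    then have "y < n" by auto
    from y self[OF this] show "y \<in> (\<Union>x\<in>{1..n - 1}. orbit ?f x)"
      by (rule UN_I)
  qed
  then have "card (\<Union>(cyclotomic_cosets a n)) = card (cyclotomic_cosets a n) * ?h"
    using eq by simp
  moreover have "card C \<le> ?h" if "C \<in> cyclotomic_cosets a n" for C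
  proof -
    from that obtain y where y: "y \<in> {1..n - 1}" "C = orbit ?f y"
      unfolding cyclotomic_cosets_def by (rule imageE)
    then have "y < n" by auto
    then show ?thesis
      unfolding y(2) by (intro card_orbit_le[OF h] period)
  qed
  moreover have "finite (cyclotomic_cosets a n)" "orbit ?f x \<in> cyclotomic_cosets a n"
    using assms(2) unfolding cyclotomic_cosets_def by (intro finite_imageI finite_atLeastAtMost imageI)+
  ultimately show ?thesis
    using card_eq_if_cover by blast
qed

lemma overpseudoprime_ord_eq:
  assumes "overpseudoprime a n" and "prime p" and "p dvd n"
  shows "ord n a = ord p a"
proof -
  let ?f = "\<lambda>x. a * x mod n"
  have n: "n > 1" and cop: "coprime n a"
    using assms(1) by (auto simp: overpseudoprime_def)
  obtain m where m: "n = p * m"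
    using assms(3) by blast
  have "m \<noteq> 0" "m < n"
    using m n assms(2) prime_gt_1_nat by (auto intro: Nat.gr0I)
  have pos: "ord p a > 0"
    using cop m by (simp add: coprime_commute)
  \<comment> \<open>Scaling by \<open>m\<close> lifts the congruence from modulus \<open>p\<close>
    to modulus \<open>n\<close>, so the coset of \<open>m\<close> closes after
    \<open>ord p a\<close> steps.\<close>
  have "[a ^ ord p a * m = 1 * m] (mod p * m)"
    using ord[of a p] unfolding cong_def mod_mult_mult2 by simp
  then have "(?f ^^ ord p a) m = m"
    using \<open>m < n\<close> by (simp add: funpow_mult_mod cong_def m)
  then have "card (orbit ?f m) \<le> ord p a"
    by (rule card_orbit_le[OF pos])
  moreover have "card (orbit ?f m) = ord n a"
    using \<open>m \<noteq> 0\<close> \<open>m < n\<close> by (intro overpseudoprime_card_orbit assms) auto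
  moreover have "ord p a dvd ord n a"
    using ord[of a n] assms(3) by (simp add: cong_dvd_modulus_nat flip: ord_divides)
  moreover have "ord n a > 0"
    using cop by (simp add: coprime_commute)
  ultimately show ?thesis
    by (simp add: dvd_imp_le le_antisym)
qed

theorem theorem11:
  fixes a n :: nat
  assumes "a > 1"
    and "overpseudoprime a n"
    and "\<And>p. wieferich_prime a p \<Longrightarrow> \<not> p ^ 2 dvd n"
  shows "squarefree n"
proof (rule ccontr)
  have n: "n > 1" and cop: "coprime n a"
    using assms(2) by (auto simp: overpseudoprime_def)
  assume "\<not> squarefree n"
  then obtain p where p: "prime p" "p ^ 2 dvd n"
    using n by (auto simp: squarefree_factorial_semiring)
  then have "p dvd n"
    by (metis dvd_trans dvd_triv_left power2_eq_square)
  have "coprime p a"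
    using coprime_divisors[OF \<open>p dvd n\<close> dvd_refl cop] .
  then have "\<not> p dvd a"
    using p(1) coprime_absorb_left not_prime_unit by blast
  then have "[a ^ (p - 1) = 1] (mod p)"
    by (rule fermat_theorem[OF p(1)])
  \<comment> \<open>Equality of the two orders carries Fermat's congruence from \<open>p\<close> to
    \<open>n\<close>, and thus to its divisor \<open>p ^ 2\<close>.\<close>
  then have "ord n a dvd p - 1"
    using overpseudoprime_ord_eq[OF assms(2) p(1) \<open>p dvd n\<close>] by (metis ord_divides)
  then have "[a ^ (p - 1) = 1] (mod p ^ 2)"
    using p(2) by (simp add: cong_dvd_modulus_nat flip: ord_divides)
  then show False
    using assms(3) p by (simp add: wieferich_prime_def)
qed

end
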